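(* Let $d\ge 3$. Let $\mathcal{H}$ be the half lattice, i.e. the graph with vertex set $H=\{x\in\mathbb{Z}^d : x_1\ge 0\}$, edge set $\{\{x,y\} : \|x-y\|=1,\ x,y\in H\}$ and all conductances equal to one, and let $G_{\mathcal{H}}$ be the Green's function of the simple random walk on $\mathcal{H}$. Let $g$ be the Green's function of the simple random walk on $\mathbb{Z}^d$. For $y=(y_1,y_2,\ldots,y_d)\in\mathbb{Z}^d$ write $\overline{y}:=(-y_1,y_2,\ldots,y_d)$, and let $\mathbf{e}_{(1)}$ be the first canonical basis vector of $\mathbb{R}^d$. Then for all $x,y\in H$, \[ G_{\mathcal{H}}(x,y)=g(x,y)+g\left(x,\overline{y}-\mathbf{e}_{(1)}\right). \]
   Context: Let $\mathcal{G}=(V,E)$ be a connected graph of bounded degree in which each edge $\{x,y\}\in E$ carries a positive finite conductance $c_{\mathcal{G}}(x,y)$; write $x\sim y$ if $\{x,y\}\in E$, and $\pi_{\mathcal{G}}(x):=\sum_{y\sim x}c_{\mathcal{G}}(x,y)$. The random walk $(S_n)_{n\ge 0}$ on $\mathcal{G}$ is the discrete-time Markov chain with transition probabilities $\mathsf{P}(S_{n+1}=y\mid S_n=x)=c_{\mathcal{G}}(x,y)/\pi_{\mathcal{G}}(x)$ for $y\sim x$. When this walk is transient its (normalized) Green's function is \[ G_{\mathcal{G}}(x,y)=\frac{1}{\pi_{\mathcal{G}}(y)}\,\mathsf{E}_x\Big[\sum_{m\ge 0}\mathbf{1}_{\{S_m=y\}}\Big],\qquad x,y\in V, \] where $\mathsf{E}_x$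 is the expectation for the walk started at $x$. There is no killing on the boundary of the graph. With unit conductances $\pi_{\mathcal{G}}(x)=\deg(x)$. $g(x,y)$ denotes the Green's function in this sense of the graph with vertex set $\mathbb{Z}^d$, edge set $\{\{x,y\}:\|x-y\|=1\}$ ($\|\cdot\|$ Euclidean norm) and unit conductances; thus $g(x,y)=\frac{1}{2d}\mathsf{E}_x[\sum_{m\ge 0}\mathbf{1}_{\{S_m=y\}}]$ for the simple random walk $S$ on $\mathbb{Z}^d$. *)

theory Defs
  imports "HOL-Probability.Probability"
begin

text \<open>
  The last assumption of the locale only excludes the one-vertex graph, on which the random walk
  is not defined because the total conductance of its vertex vanishes.
\<close>

locale network =
  fixes V :: "'v set" and E :: "'v set set" and c :: "'v set \<Rightarrow> real"
  assumes edges: "e \<in> E \<Longrightarrow> \<exists>x\<in>V. \<exists>y\<in>V. x \<noteq> y \<and> e = {x, y}"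
    and conductance_pos: "e \<in> E \<Longrightarrow> 0 < c e"
    and bounded_degree: "\<exists>D. \<forall>x\<in>V. finite {y. {x, y} \<in> E} \<and> card {y. {x, y} \<in> E} \<le> D"
    and connected: "x \<in> V \<Longrightarrow> y \<in> V \<Longrightarrow> (\<lambda>u v. {u, v} \<in> E)\<^sup>*\<^sup>* x y"
    and nontrivial: "\<exists>x\<in>V. \<exists>y\<in>V. x \<noteq> y"
begin

definition weight :: "'v \<Rightarrow> real" where
  "weight x = (\<Sum>y | {x, y} \<in> E. c {x, y})"

definition trans_prob :: "'v \<Rightarrow> 'v \<Rightarrow> real" where
  "trans_prob x y = (if {x, y} \<in> E then c {x, y} / weight x else 0)"

definition step :: "'v \<Rightarrow> 'v measure" where
  "step x = point_measure V (\<lambda>y. ennreal (trans_prob x y))"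

primrec kernel :: "'v \<Rightarrow> nat \<Rightarrow> (nat \<Rightarrow> 'v) \<Rightarrow> 'v measure" where
  "kernel x 0 \<omega> = return (count_space V) x"
| "kernel x (Suc n) \<omega> = step (\<omega> n)"

text \<open>
  The law on path space \<open>nat \<Rightarrow> 'v\<close> of the random walk started at \<open>x\<close>, obtained from the
  Ionescu-Tulcea theorem; the walk itself is the coordinate process \<open>\<omega> n\<close>.  The lemma
  \<open>emeasure_walk_path\<close> below identifies its finite-dimensional distributions.
\<close>

definition walk :: "'v \<Rightarrow> (nat \<Rightarrow> 'v) measure" where
  "walk x = projective_family.lim UNIV
     (Ionescu_Tulcea.CI (kernel x) (\<lambda>_. count_space V)) (\<lambda>_. count_space V)"

text \<open>
  The values lie in \<open>[0, \<infinity>]\<close>, so the formula makes sense for every network; they are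
  finite precisely when the walk is transient.
\<close>

definition green :: "'v \<Rightarrow> 'v \<Rightarrow> ennreal" where
  "green x y = (\<integral>\<^sup>+ \<omega>. (\<Sum>m. indicator {y} (\<omega> m)) \<partial>walk x) / ennreal (weight y)"

lemma finite_nbrs: "x \<in> V \<Longrightarrow> finite {y. {x, y} \<in> E}"
  using bounded_degree by blast

lemma nbr_in: "{x, y} \<in> E \<Longrightarrow> x \<in> V \<and> y \<in> V"
  using edges[of "{x, y}"] by (auto simp: doubleton_eq_iff)

lemma weight_pos:
  assumes "x \<in> V"
  shows "0 < weight x"
proof -
  obtain z where z: "z \<in> V" "z \<noteq> x"
    using nontrivial by blast
  from connected[OF assms z(1)] have "\<exists>y. {x, y} \<in> E"
    by (cases rule: converse_rtranclpE) (use z(2) in auto)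
  then show ?thesis
    unfolding weight_def using finite_nbrs[OF assms]
    by (intro sum_pos conductance_pos) auto
qed

lemma trans_prob_nonneg: "x \<in> V \<Longrightarrow> 0 \<le> trans_prob x y"
  using weight_pos[of x] conductance_pos[of "{x, y}"]
  by (auto simp: trans_prob_def intro!: divide_nonneg_pos less_imp_le)

lemma prob_space_step:
  assumes x: "x \<in> V"
  shows "prob_space (step x)"
proof
  have "(\<integral>\<^sup>+ y. ennreal (trans_prob x y) \<partial>count_space V) =
      (\<Sum>y | {x, y} \<in> E. ennreal (trans_prob x y))"
    using finite_nbrs[OF x] nbr_in[of x]
    by (intro nn_integral_count_space') (auto simp: trans_prob_def)
  also have "\<dots> = ennreal (\<Sum>y | {x, y} \<in> E. trans_prob x y)"
    by (intro sum_ennreal trans_prob_nonneg x)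
  also have "(\<Sum>y | {x, y} \<in> E. trans_prob x y) = (\<Sum>y | {x, y} \<in> E. c {x, y} / weight x)"
    by (intro sum.cong) (auto simp: trans_prob_def)
  also have "\<dots> = 1"
    using weight_pos[OF x] by (simp add: sum_divide_distrib[symmetric] weight_def)
  finally show "emeasure (step x) (space (step x)) = 1"
    unfolding step_def space_point_measure point_measure_def
    by (subst emeasure_density) (auto intro: trans[OF nn_integral_cong])
qed

lemma step_measurable: "step \<in> measurable (count_space V) (subprob_algebra (count_space V))"
  unfolding measurable_count_space_eq1
proof
  fix x assume "x \<in> V"
  then show "step x \<in> space (subprob_algebra (count_space V))"
    using prob_space_imp_subprob_space[OF prob_space_step]
    by (simp add: space_subprob_algebra step_def sets_point_measure)
qed

lemma Ionescu_Tulcea_kernel: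
  assumes x: "x \<in> V"
  shows "Ionescu_Tulcea (kernel x) (\<lambda>_. count_space V)"
proof (rule Ionescu_Tulcea.intro)
  fix i
  show "kernel x i \<in> measurable (PiM {0..<i} (\<lambda>_. count_space V)) (subprob_algebra (count_space V))"
  proof (cases i)
    case 0
    then show ?thesis
      using x by (auto intro!: measurable_const simp: space_subprob_algebra
          prob_space_imp_subprob_space prob_space_return cong: measurable_cong)
  next
    case (Suc n)
    have "(\<lambda>\<omega>. step (\<omega> n)) \<in> measurable (PiM {0..<Suc n} (\<lambda>_. count_space V))
        (subprob_algebra (count_space V))"
      by (rule measurable_compose[where g = step, OF _ step_measurable])
        (rule measurable_component_singleton, simp)
    moreover have "kernel x (Suc n) = (\<lambda>\<omega>. step (\<omega> n))"
      by auto
    ultimately show ?thesis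
      unfolding Suc by (simp only:)
  qed
next
  fix i and \<omega> :: "nat \<Rightarrow> 'v"
  assume "\<omega> \<in> space (PiM {0..<i} (\<lambda>_. count_space V))"
  then show "prob_space (kernel x i \<omega>)"
    using x by (cases i) (auto simp: space_PiM PiE_iff intro!: prob_space_return prob_space_step)
qed

lemma sets_walk:
  assumes "x \<in> V"
  shows "sets (walk x) = sets (PiM UNIV (\<lambda>_. count_space V))"
proof -
  interpret IT: Ionescu_Tulcea "kernel x" "\<lambda>_. count_space V"
    by (rule Ionescu_Tulcea_kernel[OF assms])
  show ?thesis
    by (simp add: walk_def)
qed

lemma emeasure_walk_path:
  assumes x: "x \<in> V" and p: "\<And>i. i \<le> n \<Longrightarrow> p i \<in> V"
  shows "emeasure (walk x) {\<omega> \<in> space (walk x). \<forall>i\<le>n. \<omega> i = p i} =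
    (if p 0 = x then ennreal (\<Prod>i<n. trans_prob (p i) (p (Suc i))) else 0)"
proof -
  interpret IT: Ionescu_Tulcea "kernel x" "\<lambda>_. count_space V"
    by (rule Ionescu_Tulcea_kernel[OF x])
  let ?M = "\<lambda>m. PiM {0..<m} (\<lambda>_ :: nat. count_space V)"
  let ?u = "\<lambda>_ :: nat. undefined :: 'v"
  define A where "A m = PiE {0..<m} (\<lambda>i. {p i})" for m
  have u: "?u \<in> space (?M 0)"
    by (simp add: space_PiM)
  have A: "A m \<in> sets (?M m)" if "m \<le> Suc n" for m
    unfolding A_def using that p by (intro sets_PiM_I_finite) auto
  have eP: "emeasure (IT.eP m \<omega>) (A (Suc m)) =
      indicator (A m) \<omega> * emeasure (kernel x m p) {p m}"
    if \<omega>: "\<omega> \<in> space (?M m)" and m: "m \<le> n" for m \<omega>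
  proof -
    have ext: "\<omega> \<in> extensional {0..<m}"
      using \<omega> by (simp add: space_PiM PiE_def)
    have "emeasure (IT.eP m \<omega>) (A (Suc m)) =
        emeasure (kernel x m \<omega>) (fun_upd \<omega> m -` A (Suc m) \<inter> V)"
      using IT.emeasure_eP[OF \<omega> A[of "Suc m"]] m by simp
    moreover have "fun_upd \<omega> m -` A (Suc m) \<inter> V = (if \<omega> \<in> A m then {p m} else {})"
      using ext p[OF m] by (auto simp: A_def PiE_iff extensional_def split: if_splits)
    moreover have "kernel x m \<omega> = kernel x m p" if "\<omega> \<in> A m"
      using that by (cases m) (auto simp: A_def PiE_iff)
    ultimately show ?thesis
      by (auto split: split_indicator)
  qed
  have C: "emeasure (IT.C 0 m ?u) (A m) = (\<Prod>i<m. emeasure (kernel x i p) {p i})"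
    if "m \<le> Suc n" for m
    using that
  proof (induction m)
    case 0
    then show ?case
      using emeasure_return[OF A[of 0], of ?u] by (simp add: A_def)
  next
    case (Suc m)
    have sp: "space (IT.C 0 m ?u) = space (?M m)" and se: "sets (IT.C 0 m ?u) = sets (?M m)"
      using IT.space_C[OF u, of m] IT.sets_C[OF u, of m] by simp_all
    have ne: "space (IT.C 0 m ?u) \<noteq> {}"
      using IT.prob_space_C[OF u, of m] by (rule prob_space.not_empty)
    have meas: "IT.eP m \<in> measurable (IT.C 0 m ?u) (subprob_algebra (?M (Suc m)))"
      using IT.measurable_eP[of m] by (simp cong: measurable_cong_sets add: measurable_cong_sets[OF se refl])
    have "emeasure (IT.C 0 (Suc m) ?u) (A (Suc m)) =
        (\<integral>\<^sup>+ \<omega>. emeasure (IT.eP m \<omega>) (A (Suc m)) \<partial>IT.C 0 m ?u)"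
      using emeasure_bind[OF ne meas A[OF Suc.prems]] by simp
    also have "\<dots> = (\<integral>\<^sup>+ \<omega>. indicator (A m) \<omega> * emeasure (kernel x m p) {p m} \<partial>IT.C 0 m ?u)"
      using Suc.prems by (intro nn_integral_cong eP) (auto simp: sp)
    also have "\<dots> = emeasure (IT.C 0 m ?u) (A m) * emeasure (kernel x m p) {p m}"
      using A[of m] Suc.prems
      by (subst nn_integral_multc) (auto simp: se intro!: borel_measurable_indicator)
    finally show ?case
      using Suc by simp
  qed
  have "{\<omega> \<in> space (walk x). \<forall>i\<le>n. \<omega> i = p i} =
      prod_emb UNIV (\<lambda>_. count_space V) {0..<Suc n} (A (Suc n))"
    using sets_eq_imp_space_eq[OF sets_walk[OF x]]
    by (auto simp: prod_emb_def A_def PiE_iff space_PiM restrict_def less_Suc_eq_le)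
  then have "emeasure (walk x) {\<omega> \<in> space (walk x). \<forall>i\<le>n. \<omega> i = p i} =
      emeasure (IT.CI {0..<Suc n}) (A (Suc n))"
    unfolding walk_def using IT.lim[OF _ A[of "Suc n"]] by simp
  also have "\<dots> = emeasure (IT.C 0 (Suc n) ?u) (A (Suc n))"
    using IT.emeasure_CI[of "{0..<Suc n}" "Suc n" "A (Suc n)"] A[of "Suc n"]
      sets.sets_into_space[OF A[of "Suc n"]]
    by (simp add: prod_emb_id space_PiM del: IT.C.simps)
  also have "\<dots> = emeasure (return (count_space V) x) {p 0} *
      (\<Prod>i<n. emeasure (step (p i)) {p (Suc i)})"
    by (subst C[OF order_refl]) (simp add: prod.lessThan_Suc_shift del: prod.lessThan_Suc)
  also have "(\<Prod>i<n. emeasure (step (p i)) {p (Suc i)}) =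
      (\<Prod>i<n. ennreal (trans_prob (p i) (p (Suc i))))"
    using p by (intro prod.cong refl) (simp add: step_def emeasure_point_measure_finite2)
  also have "\<dots> = ennreal (\<Prod>i<n. trans_prob (p i) (p (Suc i)))"
    using p by (intro prod_ennreal trans_prob_nonneg) auto
  also have "emeasure (return (count_space V) x) {p 0} = (if p 0 = x then 1 else 0)"
    using p[of 0] by (auto simp: emeasure_return indicator_def)
  finally show ?thesis
    by simp
qed

end

text \<open>Nearest-neighbour edges of the subgraph of the integer lattice induced by a vertex set.\<close>

definition nn_edges :: "(int ^ 'd) set \<Rightarrow> (int ^ 'd) set set" where
  "nn_edges V = {{x, y} | x y. x \<in> V \<and> y \<in> V \<and> norm (\<chi> i. real_of_int (x $ i - y $ i)) = 1}"

text \<open>The coordinate \<open>k\<close> plays the role of the first one.\<close>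

definition half_lattice :: "'d \<Rightarrow> (int ^ 'd) set" where
  "half_lattice k = {x. 0 \<le> x $ k}"

definition reflect :: "'d \<Rightarrow> int ^ 'd \<Rightarrow> int ^ 'd" where
  "reflect k y = (\<chi> i. if i = k then - (y $ i) else y $ i)"

definition srw_green :: "(int ^ 'd) set \<Rightarrow> int ^ 'd \<Rightarrow> int ^ 'd \<Rightarrow> ennreal" where
  "srw_green V = network.green V (nn_edges V) (\<lambda>_. 1)"

lemma norm_int_vec_eq_1_iff:
  fixes x y :: "int ^ 'd"
  shows "norm (\<chi> i. real_of_int (x $ i - y $ i)) = 1 \<longleftrightarrow>
    (\<exists>i s. (s = 1 \<or> s = - 1) \<and> y = x + axis i s)"
proof
  assume "norm (\<chi> i. real_of_int (x $ i - y $ i)) = 1"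
  then have "(\<Sum>i\<in>UNIV. (real_of_int (x $ i - y $ i))\<^sup>2) = 1"
    by (simp add: norm_vec_def L2_set_def)
  then have "real_of_int (\<Sum>i\<in>UNIV. (y $ i - x $ i)\<^sup>2) = 1"
    by (simp add: power2_commute)
  then have 1: "(\<Sum>i\<in>UNIV. (y $ i - x $ i)\<^sup>2) = 1"
    by linarith
  then obtain i where i: "(y $ i - x $ i)\<^sup>2 \<noteq> 0"
    by (metis (no_types, lifting) sum.neutral zero_neq_one)
  have "(y $ i - x $ i)\<^sup>2 + (\<Sum>j\<in>UNIV - {i}. (y $ j - x $ j)\<^sup>2) = 1"
    using 1 by (subst (asm) sum.remove[of _ i]) auto
  moreover have "0 \<le> (\<Sum>j\<in>UNIV - {i}. (y $ j - x $ j)\<^sup>2)"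
    by (intro sum_nonneg) auto
  moreover have "0 < (y $ i - x $ i)\<^sup>2"
    using i by simp
  ultimately have s: "(y $ i - x $ i)\<^sup>2 = 1" and "(\<Sum>j\<in>UNIV - {i}. (y $ j - x $ j)\<^sup>2) = 0"
    by linarith+
  then have "\<forall>j\<in>UNIV - {i}. (y $ j - x $ j)\<^sup>2 = 0"
    by (subst (asm) sum_nonneg_eq_0_iff) auto
  then have "y = x + axis i (y $ i - x $ i)"
    by (auto simp: vec_eq_iff axis_def)
  with s show "\<exists>i s. (s = 1 \<or> s = - 1) \<and> y = x + axis i s"
    by (metis power2_eq_1_iff)
next
  assume "\<exists>i s. (s = 1 \<or> s = - 1) \<and> y = x + axis i s"
  then obtain i s where "s = 1 \<or> s = - 1" and y: "y = x + axis i s"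
    by blast
  then have "(\<Sum>j\<in>UNIV. (real_of_int (x $ j - y $ j))\<^sup>2) = (\<Sum>j\<in>UNIV. if j = i then 1 else 0)"
    by (intro sum.cong) (auto simp: axis_def)
  then show "norm (\<chi> i. real_of_int (x $ i - y $ i)) = 1"
    by (simp add: norm_vec_def L2_set_def)
qed

lemma nn_edges_iff:
  "{x, y} \<in> nn_edges V \<longleftrightarrow>
    x \<in> V \<and> y \<in> V \<and> (\<exists>i s. (s = 1 \<or> s = - 1) \<and> y = x + axis i s)"
proof -
  have "norm (\<chi> i. real_of_int (x $ i - y $ i)) = norm (\<chi> i. real_of_int (y $ i - x $ i))"
    by (simp add: norm_vec_def L2_set_def power2_commute)
  then show ?thesis
    unfolding norm_int_vec_eq_1_iff[symmetric] nn_edges_def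
    by (auto simp: doubleton_eq_iff)
qed

lemma network_nn_edges:
  fixes V :: "(int ^ 'd) set"
  assumes 0: "0 \<in> V" "axis k 1 \<in> V"
    and V: "\<And>x i. x \<in> V \<Longrightarrow> x $ i \<noteq> 0 \<Longrightarrow> x - axis i (sgn (x $ i)) \<in> V"
  shows "network V (nn_edges V) (\<lambda>_. 1)"
proof
  fix e assume "e \<in> nn_edges V"
  then obtain x y where "x \<in> V" "y \<in> V" "e = {x, y}"
    "norm (\<chi> i. real_of_int (x $ i - y $ i)) = 1"
    unfolding nn_edges_def by blast
  moreover from this(4) have "x \<noteq> y"
    by (auto simp: norm_vec_def L2_set_def)
  ultimately show "\<exists>x\<in>V. \<exists>y\<in>V. x \<noteq> y \<and> e = {x, y}"
    by blast
next
  let ?N = "\<lambda>x. (\<lambda>(i, s). x + axis i s) ` (UNIV \<times> {1, - 1 :: int}) :: (int ^ 'd) set"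
  have "{y. {x, y} \<in> nn_edges V} \<subseteq> ?N x" for x
    by (auto simp: nn_edges_iff)
  moreover have "finite (?N x)" and "card (?N x) \<le> card (UNIV \<times> {1, - 1 :: int} :: ('d \<times> int) set)" for x
    by (simp, rule card_image_le, simp)
  ultimately have "finite {y. {x, y} \<in> nn_edges V} \<and>
      card {y. {x, y} \<in> nn_edges V} \<le> card (UNIV \<times> {1, - 1 :: int} :: ('d \<times> int) set)" for x
    using finite_subset card_mono order_trans by meson
  then show "\<exists>D. \<forall>x\<in>V. finite {y. {x, y} \<in> nn_edges V} \<and> card {y. {x, y} \<in> nn_edges V} \<le> D"
    by blast
next
  let ?R = "\<lambda>u v. {u, v} \<in> nn_edges V"
  have sym: "symp ?R\<^sup>*\<^sup>*"
    by (intro symp_rtranclp) (simp add: symp_def insert_commute)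
  have *: "?R\<^sup>*\<^sup>* x 0" if "x \<in> V" for x
    using that
  proof (induction "nat (\<Sum>i\<in>UNIV. \<bar>x $ i\<bar>)" arbitrary: x rule: less_induct)
    case less
    show ?case
    proof (cases "x = 0")
      case False
      then obtain i where i: "x $ i \<noteq> 0"
        by (auto simp: vec_eq_iff)
      define z where "z = x - axis i (sgn (x $ i))"
      have z: "z \<in> V"
        using V[OF less.prems i] by (simp add: z_def)
      have "(\<Sum>j\<in>UNIV. \<bar>z $ j\<bar>) < (\<Sum>j\<in>UNIV. \<bar>x $ j\<bar>)"
        using i by (intro sum_strict_mono_ex1) (auto simp: z_def axis_def sgn_if)
      moreover have "0 \<le> (\<Sum>j\<in>UNIV. \<bar>z $ j\<bar>)"
        by (intro sum_nonneg) auto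
      ultimately have "?R\<^sup>*\<^sup>* z 0"
        by (intro less.hyps z) linarith
      moreover have "z = x + axis i (- sgn (x $ i))"
        by (auto simp: z_def vec_eq_iff axis_def)
      then have "?R x z"
        unfolding nn_edges_iff using z less.prems i by (auto simp: sgn_if)
      ultimately show ?thesis
        by (rule converse_rtranclp_into_rtranclp[rotated])
    qed simp
  qed
  fix x y assume "x \<in> V" "y \<in> V"
  then show "?R\<^sup>*\<^sup>* x y"
    using *[of x] *[of y] sym by (meson rtranclp_trans sympD)
next
  have "(0 :: int ^ 'd) \<noteq> axis k 1"
    by (auto simp: vec_eq_iff axis_def)
  then show "\<exists>x\<in>V. \<exists>y\<in>V. x \<noteq> y"
    using 0 by blast
qed simp

lemma network_lattice: "network UNIV (nn_edges UNIV) (\<lambda>_. 1)"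
  by (rule network_nn_edges) auto

lemma network_half_lattice: "network (half_lattice k) (nn_edges (half_lattice k)) (\<lambda>_. 1)"
  by (rule network_nn_edges[where k = k]) (auto simp: half_lattice_def axis_def sgn_if)

end

theory Submission
  imports Defs
begin

text \<open>
  The proof is the reflection principle for \<open>\<sigma> y = reflect k y - axis k 1\<close>, the reflection of
  the lattice in the hyperplane \<open>y\<^sub>k = - 1/2\<close>, which exchanges the half lattice \<open>H\<close> and its
  complement.  Folding the walk on the whole lattice along \<open>\<sigma>\<close> gives a walk on \<open>H\<close> which at a
  boundary vertex stays put when the original walk steps across the hyperplane; apart from these
  holding times it is the simple random walk on \<open>H\<close>.  The holding times increase the number of
  visits to a boundary vertex by the factor \<open>2 d / (2 d - 1)\<close>, and this is the ratio of the degrees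
  in the two graphs, by which the Green's functions are normalised.

  The folding is carried out on equations instead of on paths.  On every network, decomposing
  according to the last step shows that \<open>G = green x\<close> solves
  \<open>\<pi> y * G y = indicator {x} y + (\<Sum>z\<sim>y. c {y, z} * G z)\<close> (lemma \<open>weight_green\<close>), and
  \<open>G\<close> is below every function with values in \<open>[0, \<infinity>]\<close> for which the left-hand side is at
  least the right-hand side (lemma \<open>green_least\<close>).  Let \<open>g\<close> be the Green's function of the lattice
  and \<open>R y = g x y + g x (\<sigma> y)\<close>.  Adding the equations of \<open>g\<close> at \<open>y\<close> and \<open>\<sigma> y\<close> gives an
  equation for \<open>R\<close> on \<open>H\<close> with the degree \<open>2 d\<close>, in which a boundary vertex \<open>y\<close> has itself
  as a neighbour because its lattice neighbour outside \<open>H\<close> is \<open>\<sigma> y\<close> and \<open>R (\<sigma> y) = R y\<close> (lemma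
  \<open>fold_lattice_equation\<close>).

  Cancelling this term \<open>R y\<close> turns the equation into that of \<open>H\<close>, whence \<open>G\<^sub>H \<le> R\<close> by
  minimality.  Where \<open>R y = \<infinity>\<close> cancellation is impossible, but then the required inequality is
  trivial.  Conversely, adding \<open>G\<^sub>H x y\<close> to both sides of the equation of \<open>H\<close> at the boundary
  shows that \<open>G\<^sub>H\<close> solves the folded equation, and by induction it dominates all partial sums of
  the series \<open>R\<close>.
\<close>

section \<open>One-dimensional distributions of the walk\<close>

context network
begin

lemma emeasure_walk_cylinder:
  assumes x: "x \<in> V" and B: "B \<in> sets (PiM {0..<m} (\<lambda>_ :: nat. count_space V))"
  shows "emeasure (walk x) (prod_emb UNIV (\<lambda>_. count_space V) {0..<m} B) =
    emeasure (Ionescu_Tulcea.C (kernel x) (\<lambda>_. count_space V) 0 m (\<lambda>_. undefined)) B"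
proof -
  interpret IT: Ionescu_Tulcea "kernel x" "\<lambda>_. count_space V"
    by (rule Ionescu_Tulcea_kernel[OF x])
  have "emeasure (walk x) (prod_emb UNIV (\<lambda>_. count_space V) {0..<m} B) =
      emeasure (IT.CI {0..<m}) B"
    unfolding walk_def using B by (intro IT.lim) auto
  also have "\<dots> = emeasure (IT.C 0 m (\<lambda>_. undefined)) B"
    using IT.emeasure_CI[of "{0..<m}" m B] B sets.sets_into_space[OF B]
    by (simp add: prod_emb_id space_PiM)
  finally show ?thesis .
qed

definition visit_prob :: "'v \<Rightarrow> nat \<Rightarrow> 'v \<Rightarrow> ennreal" where
  "visit_prob x n y = emeasure (walk x) {\<omega> \<in> space (walk x). \<omega> n = y}"

lemma visit_prob_0:
  assumes "x \<in> V" "y \<in> V"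
  shows "visit_prob x 0 y = indicator {x} y"
  using emeasure_walk_path[of x 0 "\<lambda>_. y"] assms
  by (simp add: visit_prob_def indicator_def)

text \<open>
  The Markov property at time \<open>n\<close>.  Decomposing according to the last step, not the first, keeps
  the starting point fixed, so that all recursions below take place in the second argument of the
  Green's function.  In the Ionescu-Tulcea construction this is the integral of the one-step
  kernel against the law \<open>?C\<close> of the first \<open>n + 1\<close> coordinates; the integrand only takes
  finitely many nonzero values since \<open>y\<close> has finitely many neighbours.
\<close>

lemma visit_prob_Suc:
  assumes x: "x \<in> V" and y: "y \<in> V"
  shows "visit_prob x (Suc n) y = (\<Sum>z | {y, z} \<in> E. ennreal (trans_prob z y) * visit_prob x n z)"
proof -
  interpret IT: Ionescu_Tulcea "kernel x" "\<lambda>_. count_space V"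
    by (rule Ionescu_Tulcea_kernel[OF x])
  let ?M = "\<lambda>m. PiM {0..<m} (\<lambda>_ :: nat. count_space V)"
  let ?u = "\<lambda>_ :: nat. undefined :: 'v"
  define A where "A m z = {\<omega> \<in> space (?M (Suc m)). \<omega> m = z}" for m z
  have A: "A m z \<in> sets (?M (Suc m))" if "z \<in> V" for m z
  proof -
    have "A m z = (\<lambda>\<omega>. \<omega> m) -` {z} \<inter> space (?M (Suc m))"
      by (auto simp: A_def)
    also have "\<dots> \<in> sets (?M (Suc m))"
      using that by (intro measurable_sets[where A = "count_space V"] measurable_component_singleton) auto
    finally show ?thesis .
  qed
  have visit: "visit_prob x m z = emeasure (IT.C 0 (Suc m) ?u) (A m z)" if "z \<in> V" for m z
  proof -
    have "{\<omega> \<in> space (walk x). \<omega> m = z} =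
        prod_emb UNIV (\<lambda>_. count_space V) {0..<Suc m} (A m z)"
      using sets_eq_imp_space_eq[OF sets_walk[OF x]]
      by (auto simp: prod_emb_def A_def space_PiM restrict_def PiE_iff extensional_def)
    then show ?thesis
      using emeasure_walk_cylinder[OF x A[OF that]] by (simp add: visit_prob_def)
  qed
  have u: "?u \<in> space (?M 0)"
    by (simp add: space_PiM)
  let ?C = "IT.C 0 (Suc n) ?u"
  have sp: "space ?C = space (?M (Suc n))" and se: "sets ?C = sets (?M (Suc n))"
    using IT.space_C[OF u, of "Suc n"] IT.sets_C[OF u, of "Suc n"] by (simp_all del: IT.C.simps)
  have ne: "space ?C \<noteq> {}"
    using IT.prob_space_C[OF u, of "Suc n"] by (rule prob_space.not_empty)
  have meas: "IT.eP (Suc n) \<in> measurable ?C (subprob_algebra (?M (Suc (Suc n))))"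
    using IT.measurable_eP[of "Suc n"]
    by (simp add: measurable_cong_sets[OF se refl] del: IT.C.simps)
  have eP: "emeasure (IT.eP (Suc n) \<omega>) (A (Suc n) y) =
      (\<Sum>z | {y, z} \<in> E. ennreal (trans_prob z y) * indicator (A n z) \<omega>)"
    if \<omega>: "\<omega> \<in> space (?M (Suc n))" for \<omega>
  proof -
    have V: "\<omega> n \<in> V"
      using \<omega> by (auto simp: space_PiM PiE_iff)
    have "emeasure (IT.eP (Suc n) \<omega>) (A (Suc n) y) =
        emeasure (step (\<omega> n)) (fun_upd \<omega> (Suc n) -` A (Suc n) y \<inter> V)"
      using IT.emeasure_eP[OF \<omega> A[OF y]] by simp
    also have "fun_upd \<omega> (Suc n) -` A (Suc n) y \<inter> V = {y}"
      using \<omega> y by (auto simp: A_def space_PiM PiE_iff extensional_def)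
    also have "emeasure (step (\<omega> n)) {y} = ennreal (trans_prob (\<omega> n) y)"
      using y by (simp add: step_def emeasure_point_measure_finite2)
    also have "\<dots> = (\<Sum>z | {y, z} \<in> E. if \<omega> n = z then ennreal (trans_prob z y) else 0)"
      using finite_nbrs[OF y] by (auto simp: trans_prob_def insert_commute)
    also have "\<dots> = (\<Sum>z | {y, z} \<in> E. ennreal (trans_prob z y) * indicator (A n z) \<omega>)"
      using \<omega> by (intro sum.cong refl) (auto simp: A_def split: split_indicator)
    finally show ?thesis .
  qed
  have AC: "A n z \<in> sets ?C" if "{y, z} \<in> E" for z
    using A[of z n] nbr_in[OF that] by (simp only: se)
  have "visit_prob x (Suc n) y = (\<integral>\<^sup>+ \<omega>. emeasure (IT.eP (Suc n) \<omega>) (A (Suc n) y) \<partial>?C)"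
    using emeasure_bind[OF ne meas A[OF y]] visit[OF y, of "Suc n"] by simp
  also have "\<dots> = (\<integral>\<^sup>+ \<omega>. (\<Sum>z | {y, z} \<in> E. ennreal (trans_prob z y) * indicator (A n z) \<omega>) \<partial>?C)"
    by (intro nn_integral_cong eP) (simp only: sp)
  also have "\<dots> = (\<Sum>z | {y, z} \<in> E. ennreal (trans_prob z y) * emeasure ?C (A n z))"
    using AC by (subst nn_integral_sum) (auto simp: nn_integral_cmult_indicator simp del: IT.C.simps)
  also have "\<dots> = (\<Sum>z | {y, z} \<in> E. ennreal (trans_prob z y) * visit_prob x n z)"
    using nbr_in[of y] by (intro sum.cong refl) (simp add: visit del: IT.C.simps)
  finally show ?thesis .
qed

section \<open>The Green's function as a least solution\<close>

definition green_term :: "'v \<Rightarrow> nat \<Rightarrow> 'v \<Rightarrow> ennreal" where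
  "green_term x n y = visit_prob x n y / ennreal (weight y)"

lemma green_eq_suminf:
  assumes x: "x \<in> V" and y: "y \<in> V"
  shows "green x y = (\<Sum>n. green_term x n y)"
proof -
  have meas: "{\<omega> \<in> space (walk x). \<omega> n = y} \<in> sets (walk x)" for n
  proof -
    have "{\<omega> \<in> space (walk x). \<omega> n = y} = (\<lambda>\<omega>. \<omega> n) -` {y} \<inter> space (walk x)"
      by auto
    also have "\<dots> \<in> sets (walk x)"
      unfolding measurable_cong_sets[OF sets_walk[OF x] refl]
      using y by (intro measurable_sets[where A = "count_space V"])
        (auto simp: measurable_cong_sets[OF sets_walk[OF x] refl])
    finally show ?thesis .
  qed
  have "(\<integral>\<^sup>+ \<omega>. (\<Sum>m. indicator {y} (\<omega> m)) \<partial>walk x) =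
      (\<integral>\<^sup>+ \<omega>. (\<Sum>m. indicator {\<omega> \<in> space (walk x). \<omega> m = y} \<omega>) \<partial>walk x)"
    by (intro nn_integral_cong suminf_cong) (auto split: split_indicator)
  also have "\<dots> = (\<Sum>m. visit_prob x m y)"
    using meas by (subst nn_integral_suminf) (auto simp: visit_prob_def)
  finally show ?thesis
    by (simp add: green_def green_term_def divide_ennreal_def)
qed

lemma weight_green_term:
  assumes "y \<in> V"
  shows "ennreal (weight y) * green_term x n y = visit_prob x n y"
proof -
  have "ennreal (weight y) * green_term x n y =
      (visit_prob x n y * ennreal (weight y)) / ennreal (weight y)"
    by (simp add: green_term_def ennreal_times_divide mult.commute)
  also have "\<dots> = visit_prob x n y"
    using weight_pos[OF assms] by (intro ennreal_mult_divide_eq) auto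
  finally show ?thesis .
qed

lemma weight_green_term_0:
  assumes "x \<in> V" "y \<in> V"
  shows "ennreal (weight y) * green_term x 0 y = indicator {x} y"
  by (simp add: weight_green_term visit_prob_0 assms)

text \<open>
  The normalisation makes the recursion symmetric: since
  \<open>trans_prob z y / weight y = c {y, z} / (weight z * weight y)\<close>, the total conductances of the
  predecessors \<open>z\<close> are absorbed by the terms \<open>green_term x n z\<close>.
\<close>

lemma weight_green_term_Suc:
  assumes x: "x \<in> V" and y: "y \<in> V"
  shows "ennreal (weight y) * green_term x (Suc n) y =
    (\<Sum>z | {y, z} \<in> E. ennreal (c {y, z}) * green_term x n z)"
proof -
  have "visit_prob x (Suc n) y = (\<Sum>z | {y, z} \<in> E. ennreal (c {y, z}) * green_term x n z)"
    unfolding visit_prob_Suc[OF assms]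
  proof (intro sum.cong refl)
    fix z assume "z \<in> {z. {y, z} \<in> E}"
    then have z: "{y, z} \<in> E" "z \<in> V"
      using nbr_in[of y z] by auto
    then have "ennreal (trans_prob z y) = ennreal (c {y, z}) / ennreal (weight z)"
      using weight_pos[OF z(2)] conductance_pos[OF z(1)]
      by (simp add: trans_prob_def insert_commute divide_ennreal)
    then show "ennreal (trans_prob z y) * visit_prob x n z = ennreal (c {y, z}) * green_term x n z"
      by (simp add: green_term_def divide_ennreal_def ac_simps)
  qed
  then show ?thesis
    by (simp add: weight_green_term y)
qed

text \<open>
  Partial sums serve to prove upper bounds on the Green's function by induction on the number of
  terms.
\<close>

definition green_upto :: "'v \<Rightarrow> nat \<Rightarrow> 'v \<Rightarrow> ennreal" where
  "green_upto x N y = (\<Sum>n<N. green_term x n y)"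

lemma green_eq_SUP:
  assumes "x \<in> V" "y \<in> V"
  shows "green x y = (SUP N. green_upto x N y)"
  unfolding green_eq_suminf[OF assms] green_upto_def by (rule suminf_eq_SUP)

lemma incseq_green_upto: "incseq (\<lambda>N. green_upto x N y)"
  unfolding green_upto_def by (intro incseq_SucI) simp

lemma weight_green_upto_Suc:
  assumes x: "x \<in> V" and y: "y \<in> V"
  shows "ennreal (weight y) * green_upto x (Suc N) y =
    indicator {x} y + (\<Sum>z | {y, z} \<in> E. ennreal (c {y, z}) * green_upto x N z)"
proof -
  have "ennreal (weight y) * green_upto x (Suc N) y =
      ennreal (weight y) * green_term x 0 y + (\<Sum>n<N. ennreal (weight y) * green_term x (Suc n) y)"
    by (simp add: green_upto_def sum.lessThan_Suc_shift distrib_left sum_distrib_left del: sum.lessThan_Suc)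
  also have "\<dots> = indicator {x} y +
      (\<Sum>n<N. \<Sum>z | {y, z} \<in> E. ennreal (c {y, z}) * green_term x n z)"
    by (simp add: weight_green_term_0 weight_green_term_Suc assms)
  also have "(\<Sum>n<N. \<Sum>z | {y, z} \<in> E. ennreal (c {y, z}) * green_term x n z) =
      (\<Sum>z | {y, z} \<in> E. ennreal (c {y, z}) * green_upto x N z)"
    by (subst sum.swap) (simp add: green_upto_def sum_distrib_left)
  finally show ?thesis .
qed

lemma weight_green:
  assumes x: "x \<in> V" and y: "y \<in> V"
  shows "ennreal (weight y) * green x y =
    indicator {x} y + (\<Sum>z | {y, z} \<in> E. ennreal (c {y, z}) * green x z)"
proof -
  have z: "green x z = (\<Sum>n. green_term x n z)" if "{y, z} \<in> E" for z
    using green_eq_suminf[OF x] nbr_in[OF that] by simp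
  have "ennreal (weight y) * green x y = (\<Sum>n. ennreal (weight y) * green_term x n y)"
    by (simp add: green_eq_suminf assms)
  also have "\<dots> = (\<Sum>n. ennreal (weight y) * green_term x (Suc n) y) +
      ennreal (weight y) * green_term x 0 y"
    using suminf_offset[of "\<lambda>n. ennreal (weight y) * green_term x n y" 1]
    by (simp add: add.commute)
  also have "\<dots> = indicator {x} y +
      (\<Sum>n. \<Sum>z | {y, z} \<in> E. ennreal (c {y, z}) * green_term x n z)"
    by (simp add: weight_green_term_0 weight_green_term_Suc assms add.commute)
  also have "(\<Sum>n. \<Sum>z | {y, z} \<in> E. ennreal (c {y, z}) * green_term x n z) =
      (\<Sum>z | {y, z} \<in> E. ennreal (c {y, z}) * green x z)"
    by (subst suminf_sum) (auto simp: z)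
  finally show ?thesis .
qed

lemma green_upto_least:
  assumes x: "x \<in> V"
    and u: "\<And>y. y \<in> V \<Longrightarrow> indicator {x} y + (\<Sum>z | {y, z} \<in> E. ennreal (c {y, z}) * u z)
      \<le> ennreal (weight y) * u y"
    and y: "y \<in> V"
  shows "green_upto x N y \<le> u y"
  using y
proof (induction N arbitrary: y)
  case (Suc N)
  have "ennreal (weight y) * green_upto x (Suc N) y \<le>
      indicator {x} y + (\<Sum>z | {y, z} \<in> E. ennreal (c {y, z}) * u z)"
    unfolding weight_green_upto_Suc[OF x Suc.prems]
    by (intro add_left_mono sum_mono mult_left_mono Suc.IH) (auto dest: nbr_in)
  also note u[OF Suc.prems]
  finally show ?case
    using weight_pos[OF Suc.prems] by (subst (asm) ennreal_mult_le_mult_iff) auto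
qed (simp add: green_upto_def)

lemma green_least:
  assumes "x \<in> V"
    and "\<And>y. y \<in> V \<Longrightarrow> indicator {x} y + (\<Sum>z | {y, z} \<in> E. ennreal (c {y, z}) * u z)
      \<le> ennreal (weight y) * u y"
    and "y \<in> V"
  shows "green x y \<le> u y"
  unfolding green_eq_SUP[OF assms(1,3)] by (intro SUP_least green_upto_least assms)

end

section \<open>Reflecting the lattice onto the half lattice\<close>

text \<open>
  The reflection in the hyperplane \<open>y\<^sub>k = - 1/2\<close>.  This hyperplane, unlike \<open>y\<^sub>k = 0\<close>, contains
  no lattice points, so every orbit has exactly one point in the half lattice.
\<close>

definition half_reflect :: "'d \<Rightarrow> int ^ 'd \<Rightarrow> int ^ 'd" where
  "half_reflect k y = reflect k y - axis k 1"

lemma half_reflect_nth: "half_reflect k y $ i = (if i = k then - (y $ k) - 1 else y $ i)"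
  by (auto simp: half_reflect_def reflect_def axis_def)

lemma half_reflect_half_reflect [simp]: "half_reflect k (half_reflect k y) = y"
  by (simp add: vec_eq_iff half_reflect_nth)

lemma half_reflect_half_lattice: "half_reflect k y \<in> half_lattice k \<longleftrightarrow> y \<notin> half_lattice k"
  by (auto simp: half_lattice_def half_reflect_nth)

lemma inj_half_reflect: "inj (half_reflect k)"
  by (metis injI half_reflect_half_reflect)

abbreviation nbrs :: "(int ^ 'd) set \<Rightarrow> int ^ 'd \<Rightarrow> (int ^ 'd) set" where
  "nbrs V y \<equiv> {z. {y, z} \<in> nn_edges V}"

lemma nbrs_half_reflect: "nbrs UNIV (half_reflect k y) = half_reflect k ` nbrs UNIV y"
proof -
  have sub: "half_reflect k ` nbrs UNIV y \<subseteq> nbrs UNIV (half_reflect k y)" for y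
  proof clarify
    fix z assume "{y, z} \<in> nn_edges UNIV"
    then obtain i s where s: "s = 1 \<or> s = - 1" and z: "z = y + axis i s"
      by (auto simp: nn_edges_iff)
    have "half_reflect k z = half_reflect k y + axis i (if i = k then - s else s)"
      by (auto simp: vec_eq_iff half_reflect_nth z axis_def)
    then show "{half_reflect k y, half_reflect k z} \<in> nn_edges UNIV"
      using s by (auto simp: nn_edges_iff intro!: exI[of _ i] exI[of _ "if i = k then - s else s"])
  qed
  have "nbrs UNIV (half_reflect k y) = half_reflect k ` half_reflect k ` nbrs UNIV (half_reflect k y)"
    by (simp add: image_image)
  also have "\<dots> \<subseteq> half_reflect k ` nbrs UNIV y"
    using sub[of "half_reflect k y"] by (intro image_mono) simp
  finally show ?thesis
    using sub[of y] by blast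
qed

text \<open>
  The only lattice edges leaving the half lattice cross the hyperplane orthogonally, hence join a
  boundary vertex to its own mirror image.
\<close>

lemma nbrs_lattice_half_lattice:
  assumes "y \<in> half_lattice k"
  shows "nbrs UNIV y = nbrs (half_lattice k) y \<union> (if y $ k = 0 then {half_reflect k y} else {})"
proof (intro set_eqI iffI)
  fix z assume "z \<in> nbrs UNIV y"
  then obtain i s where s: "s = 1 \<or> s = - 1" and z: "z = y + axis i s"
    by (auto simp: nn_edges_iff)
  show "z \<in> nbrs (half_lattice k) y \<union> (if y $ k = 0 then {half_reflect k y} else {})"
  proof (cases "z \<in> half_lattice k")
    case True
    then show ?thesis
      using assms s z by (auto simp: nn_edges_iff)
  next
    case False
    then have "i = k" "y $ k = 0" "s = - 1"
      using assms s by (auto simp: half_lattice_def z axis_def split: if_splits)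
    then have "z = half_reflect k y"
      by (auto simp: vec_eq_iff half_reflect_nth z axis_def)
    then show ?thesis
      using \<open>y $ k = 0\<close> by simp
  qed
next
  fix z assume z: "z \<in> nbrs (half_lattice k) y \<union> (if y $ k = 0 then {half_reflect k y} else {})"
  have "half_reflect k y = y + axis k (- 1)" if "y $ k = 0"
    using that by (auto simp: vec_eq_iff half_reflect_nth axis_def)
  then show "z \<in> nbrs UNIV y"
    using z by (auto simp: nn_edges_iff split: if_splits)
qed

lemma sum_nbrs_lattice:
  fixes u :: "int ^ 'd \<Rightarrow> ennreal"
  assumes y: "y \<in> half_lattice k"
  shows "sum u (nbrs UNIV y) =
    sum u (nbrs (half_lattice k) y) + (if y $ k = 0 then u (half_reflect k y) else 0)"
proof -
  have "finite (nbrs (half_lattice k) y)"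
    using network.finite_nbrs[OF network_half_lattice y] .
  moreover have "half_reflect k y \<notin> nbrs (half_lattice k) y"
    using y half_reflect_half_lattice[of k y] by (auto simp: nn_edges_iff)
  ultimately show ?thesis
    unfolding nbrs_lattice_half_lattice[OF y] by (auto simp: add.commute)
qed

section \<open>The method of images\<close>

text \<open>
  Writing the degree as a sum over the neighbours makes it an instance of the rules for such sums,
  and having it in \<open>ennreal\<close> lets the degrees of the two graphs be compared without coercions.
\<close>

definition nn_degree :: "(int ^ 'd) set \<Rightarrow> int ^ 'd \<Rightarrow> ennreal" where
  "nn_degree V y = (\<Sum>z\<in>nbrs V y. 1)"

lemma weight_eq_nn_degree:
  assumes "network V (nn_edges V) (\<lambda>_. 1)"
  shows "ennreal (network.weight (nn_edges V) (\<lambda>_. 1) y) = nn_degree V y"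
  by (simp add: network.weight_def[OF assms] nn_degree_def ennreal_of_nat_eq_real_of_nat)

lemma sum_nbrs_half_reflect:
  "sum u (nbrs UNIV (half_reflect k y)) = (\<Sum>z\<in>nbrs UNIV y. u (half_reflect k z))"
  unfolding nbrs_half_reflect
  by (subst sum.reindex) (auto intro: inj_on_subset[OF inj_half_reflect])

lemma nn_degree_half_reflect: "nn_degree UNIV (half_reflect k y) = nn_degree UNIV y"
  unfolding nn_degree_def sum_nbrs_half_reflect ..

lemma nn_degree_lattice:
  assumes "y \<in> half_lattice k"
  shows "nn_degree UNIV y = nn_degree (half_lattice k) y + (if y $ k = 0 then 1 else 0)"
  unfolding nn_degree_def by (rule sum_nbrs_lattice[OF assms])

text \<open>
  The equation on the lattice is added to its mirror image.  The mirror image of the source \<open>x\<close>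
  lies outside the half lattice and does not contribute; the neighbour of a boundary vertex on the
  other side contributes the value of \<open>u'\<close> at the vertex itself.  There are two functions \<open>u\<close> and
  \<open>v\<close> because the lemma is needed for the Green's function, where they agree, and for its partial
  sums, where \<open>v\<close> has one term more than \<open>u\<close>.
\<close>

lemma fold_lattice_equation:
  fixes u v :: "int ^ 'd \<Rightarrow> ennreal"
  assumes x: "x \<in> half_lattice k" and y: "y \<in> half_lattice k"
    and eq: "\<And>y. nn_degree UNIV y * v y = indicator {x} y + sum u (nbrs UNIV y)"
  defines "u' \<equiv> \<lambda>y. u y + u (half_reflect k y)"
  shows "nn_degree UNIV y * (v y + v (half_reflect k y)) =
    indicator {x} y + sum u' (nbrs (half_lattice k) y) + (if y $ k = 0 then u' y else 0)"
proof -
  have "indicator {x} (half_reflect k y) = (0 :: ennreal)"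
    using x y half_reflect_half_lattice[of k y] by (auto split: split_indicator)
  then have "nn_degree UNIV y * (v y + v (half_reflect k y)) =
      indicator {x} y + sum u' (nbrs UNIV y)"
    using eq[of y] eq[of "half_reflect k y"]
    by (simp add: u'_def nn_degree_half_reflect distrib_left sum_nbrs_half_reflect sum.distrib ac_simps)
  also have "sum u' (nbrs UNIV y) =
      sum u' (nbrs (half_lattice k) y) + (if y $ k = 0 then u' y else 0)"
    unfolding sum_nbrs_lattice[OF y] by (simp add: u'_def add.commute)
  finally show ?thesis
    by (simp add: ac_simps)
qed

theorem proposition1:
  fixes k :: "'d::finite" and x y :: "int ^ 'd"
  assumes "3 \<le> CARD('d)"
    and "x \<in> half_lattice k" and "y \<in> half_lattice k"
  shows "srw_green (half_lattice k) x y =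
    srw_green UNIV x y + srw_green UNIV x (reflect k y - axis k 1)"
proof -
  let ?H = "half_lattice k"
  interpret Z: network UNIV "nn_edges UNIV" "\<lambda>_. 1"
    by (rule network_lattice)
  interpret H: network ?H "nn_edges ?H" "\<lambda>_. 1"
    by (rule network_half_lattice)
  note x = assms(2)
  note wZ = weight_eq_nn_degree[OF network_lattice]
  note wH = weight_eq_nn_degree[OF network_half_lattice]
  define R where "R y = Z.green x y + Z.green x (half_reflect k y)" for y
  define R_upto where
    "R_upto N y = Z.green_upto x N y + Z.green_upto x N (half_reflect k y)" for N y
  have R: "nn_degree UNIV y * R y =
      indicator {x} y + sum R (nbrs ?H y) + (if y $ k = 0 then R y else 0)"
    if "y \<in> ?H" for y
    unfolding R_def using Z.weight_green[of x]
    by (intro fold_lattice_equation[OF x that]) (simp add: wZ)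
  have R_upto: "nn_degree UNIV y * R_upto (Suc N) y =
      indicator {x} y + sum (R_upto N) (nbrs ?H y) + (if y $ k = 0 then R_upto N y else 0)"
    if "y \<in> ?H" for N y
    unfolding R_upto_def using Z.weight_green_upto_Suc[of x _ N]
    by (intro fold_lattice_equation[OF x that]) (simp add: wZ)
  have "H.green x y \<le> R y"
  proof (rule H.green_least[OF x _ assms(3)])
    fix y assume y: "y \<in> ?H"
    show "indicator {x} y + (\<Sum>z\<in>nbrs ?H y. ennreal 1 * R z) \<le> ennreal (H.weight y) * R y"
      \<comment> \<open>At the boundary \<open>R y\<close> has to be cancelled, which needs it to be finite.\<close>
    proof (cases "R y = \<infinity>")
      case True
      then show ?thesis
        using H.weight_pos[OF y] by (simp add: ennreal_mult_top)
    next
      case False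
      then show ?thesis
        using R[OF y]
        by (auto simp: nn_degree_lattice[OF y] wH distrib_right add.commute[of _ "R y"]
            split: if_splits)
    qed
  qed
  moreover have R_upto_le: "R_upto N y \<le> H.green x y" if "y \<in> ?H" for N y
    using that
  proof (induction N arbitrary: y)
    case (Suc N)
    note y = Suc.prems
    have "nn_degree UNIV y * R_upto (Suc N) y \<le>
        indicator {x} y + (\<Sum>z\<in>nbrs ?H y. H.green x z) + (if y $ k = 0 then H.green x y else 0)"
      unfolding R_upto[OF y] using Suc.IH y
      by (intro add_mono sum_mono) (auto simp: nn_edges_iff)
    \<comment> \<open>At the boundary the extra \<open>H.green x y\<close> raises the degree by one, to that of the lattice.\<close>
    also have "\<dots> = nn_degree UNIV y * H.green x y"
      using H.weight_green[OF x y] by (simp add: nn_degree_lattice[OF y] wH distrib_right)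
    finally show ?case
      using Z.weight_pos[of y] by (simp add: wZ[symmetric] ennreal_mult_le_mult_iff)
  qed (simp add: R_upto_def Z.green_upto_def)
  have "R y = (SUP N. R_upto N y)"
    unfolding R_def R_upto_def Z.green_eq_SUP[OF UNIV_I UNIV_I]
    by (intro ennreal_SUP_add[symmetric] Z.incseq_green_upto)
  then have "R y \<le> H.green x y"
    using R_upto_le[OF assms(3)] by (simp add: SUP_least)
  ultimately show ?thesis
    by (simp add: srw_green_def R_def half_reflect_def)
qed

end
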